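(* Let $G$ be a connected graph, and let $e$ be a bridge in $G$. Suppose that $G_1$ and $G_2$ are the components of $G\setminus e$, and let $e=v_1\sim v_2$ with $v_1\in V(G_1)$ and $v_2\in V(G_2)$. Then $$\kappa(G)=\frac{m_{G_1}}{m_G}\kappa(G_1)+\frac{m_{G_2}}{m_G}\kappa(G_2)+\frac{m_{G_2}+1}{m_G}\mathbf{d}_{G_1}^TR_{G_1}\mathbf{e}_{v_1}+\frac{m_{G_1}+1}{m_G}\mathbf{d}_{G_2}^TR_{G_2}\mathbf{e}_{v_2}+\frac{(2m_{G_1}+1)(2m_{G_2}+1)}{2m_G}.$$
   Context: All graphs are finite, simple and undirected. For a graph $H$: $m_H$ is the number of edges; $\mathbf{d}_H$ is the column vector of vertex degrees; $\mathbf{e}_v$ is the standard basis vector indexed by the vertex $v$. $G\setminus e$ is $G$ with the edge $e$ removed; $e$ is a bridge of the connected graph $G$ if $G\setminus e$ is disconnected. For connected $H$, $R_H=[r^H_{u,v}]$ is the effective resistance matrix, $r^H_{u,v}=(\mathbf{e}_u-\mathbf{e}_v)^TL^\dagger(\mathbf{e}_u-\mathbf{e}_v)$ with $L^\dagger$ the Moore–Penrose inverse of the Laplacian matrix of $H$. Kemeny's constant $\kappa(H)$ of a connected graph $H$ is that of the simple random walk on $H$ (from a vertex, move to a uniformly random neighbour): $\kappa(H)=\sum_{j\neq i}\pi_jm_{i,j}$, where $\pi_j=\deg_H(j)/(2m_H)$ is the stationary distribution and $m_{i,j}$ is the mean first passage time from $i$ to $j$; it does not depend on $i$. For a graph with at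 least one edge, $\kappa(H)=\mathbf{d}_H^TR_H\mathbf{d}_H/(4m_H)$. For a single-vertex graph, $\kappa(H)=0$. *)

theory Defs
  imports "HOL-Probability.Probability_Mass_Function"
begin

section \<open>Finite simple graphs\<close>

datatype 'a ugraph = Graph (verts: "'a set") (edges: "'a set set")

definition simple_graph :: "'a ugraph \<Rightarrow> bool" where
  "simple_graph G \<longleftrightarrow> finite (verts G) \<and> (\<forall>e\<in>edges G. e \<subseteq> verts G \<and> card e = 2)"

definition num_edges :: "'a ugraph \<Rightarrow> nat" where
  "num_edges G = card (edges G)"

definition neighbours :: "'a ugraph \<Rightarrow> 'a \<Rightarrow> 'a set" where
  "neighbours G v = {u. {v, u} \<in> edges G}"

definition degree :: "'a ugraph \<Rightarrow> 'a \<Rightarrow> nat" where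
  "degree G v = card (neighbours G v)"

definition reachable :: "'a ugraph \<Rightarrow> 'a \<Rightarrow> 'a \<Rightarrow> bool" where
  "reachable G u v \<longleftrightarrow> (u, v) \<in> {(x, y). {x, y} \<in> edges G}\<^sup>*"

definition connected_graph :: "'a ugraph \<Rightarrow> bool" where
  "connected_graph G \<longleftrightarrow>
     verts G \<noteq> {} \<and> (\<forall>u\<in>verts G. \<forall>v\<in>verts G. reachable G u v)"

definition induced_subgraph :: "'a ugraph \<Rightarrow> 'a set \<Rightarrow> 'a ugraph" where
  "induced_subgraph G W = Graph W {e \<in> edges G. e \<subseteq> W}"

definition graph_components :: "'a ugraph \<Rightarrow> 'a ugraph set" where
  "graph_components G =
     (\<lambda>v. induced_subgraph G {u \<in> verts G. reachable G v u}) ` verts G"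

definition delete_edge :: "'a ugraph \<Rightarrow> 'a set \<Rightarrow> 'a ugraph" where
  "delete_edge G e = Graph (verts G) (edges G - {e})"

definition is_bridge :: "'a ugraph \<Rightarrow> 'a set \<Rightarrow> bool" where
  "is_bridge G e \<longleftrightarrow> e \<in> edges G \<and> \<not> connected_graph (delete_edge G e)"


section \<open>Vectors and matrices indexed by a finite set\<close>

text \<open>
  The vertex sets of a graph and of its subgraphs differ, so the index set \<open>V\<close> of vectors and
  matrices is an explicit argument. Only the entries with indices in \<open>V\<close> are meaningful.
\<close>

definition mat_mult_on ::
    "'a set \<Rightarrow> ('a \<Rightarrow> 'a \<Rightarrow> real) \<Rightarrow> ('a \<Rightarrow> 'a \<Rightarrow> real) \<Rightarrow> 'a \<Rightarrow> 'a \<Rightarrow> real" where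
  "mat_mult_on V A B = (\<lambda>u w. \<Sum>x\<in>V. A u x * B x w)"

definition mat_eq_on :: "'a set \<Rightarrow> ('a \<Rightarrow> 'a \<Rightarrow> real) \<Rightarrow> ('a \<Rightarrow> 'a \<Rightarrow> real) \<Rightarrow> bool" where
  "mat_eq_on V A B \<longleftrightarrow> (\<forall>u\<in>V. \<forall>w\<in>V. A u w = B u w)"

definition mat_transpose :: "('a \<Rightarrow> 'a \<Rightarrow> real) \<Rightarrow> 'a \<Rightarrow> 'a \<Rightarrow> real" where
  "mat_transpose A = (\<lambda>u w. A w u)"

text \<open>The scalar \<open>x\<^sup>T A y\<close>.\<close>

definition vec_mat_vec ::
    "'a set \<Rightarrow> ('a \<Rightarrow> real) \<Rightarrow> ('a \<Rightarrow> 'a \<Rightarrow> real) \<Rightarrow> ('a \<Rightarrow> real) \<Rightarrow> real" where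
  "vec_mat_vec V x A y = (\<Sum>u\<in>V. \<Sum>w\<in>V. x u * A u w * y w)"

definition basis_vec :: "'a \<Rightarrow> 'a \<Rightarrow> real" where
  "basis_vec v = (\<lambda>u. if u = v then 1 else 0)"

text \<open>
  The four Penrose equations. The last conjunct fixes the entries of \<open>X\<close> with an index outside
  \<open>V\<close>, which makes \<open>X\<close> unique as a function.
\<close>

definition is_moore_penrose_on ::
    "'a set \<Rightarrow> ('a \<Rightarrow> 'a \<Rightarrow> real) \<Rightarrow> ('a \<Rightarrow> 'a \<Rightarrow> real) \<Rightarrow> bool" where
  "is_moore_penrose_on V A X \<longleftrightarrow>
     mat_eq_on V (mat_mult_on V (mat_mult_on V A X) A) A \<and>
     mat_eq_on V (mat_mult_on V (mat_mult_on V X A) X) X \<and>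
     mat_eq_on V (mat_transpose (mat_mult_on V A X)) (mat_mult_on V A X) \<and>
     mat_eq_on V (mat_transpose (mat_mult_on V X A)) (mat_mult_on V X A) \<and>
     (\<forall>u w. u \<notin> V \<or> w \<notin> V \<longrightarrow> X u w = 0)"

definition moore_penrose_on :: "'a set \<Rightarrow> ('a \<Rightarrow> 'a \<Rightarrow> real) \<Rightarrow> 'a \<Rightarrow> 'a \<Rightarrow> real" where
  "moore_penrose_on V A = (THE X. is_moore_penrose_on V A X)"


section \<open>Effective resistance\<close>

definition degree_vec :: "'a ugraph \<Rightarrow> 'a \<Rightarrow> real" where
  "degree_vec G = (\<lambda>v. real (degree G v))"

definition laplacian :: "'a ugraph \<Rightarrow> 'a \<Rightarrow> 'a \<Rightarrow> real" where
  "laplacian G = (\<lambda>u v. (if u = v then real (degree G u) else 0)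
                       - (if {u, v} \<in> edges G then 1 else 0))"

definition resistance_matrix :: "'a ugraph \<Rightarrow> 'a \<Rightarrow> 'a \<Rightarrow> real" where
  "resistance_matrix G = (\<lambda>u v.
     vec_mat_vec (verts G) (\<lambda>x. basis_vec u x - basis_vec v x)
       (moore_penrose_on (verts G) (laplacian G)) (\<lambda>x. basis_vec u x - basis_vec v x))"


section \<open>Simple random walk and Kemeny's constant\<close>

text \<open>The law of the trajectory \<open>[X\<^sub>0, \<dots>, X\<^sub>n]\<close> of the simple random walk started at \<open>X\<^sub>0 = i\<close>.\<close>

fun random_walk :: "'a ugraph \<Rightarrow> nat \<Rightarrow> 'a \<Rightarrow> 'a list pmf" where
  "random_walk G 0 i = return_pmf [i]"
| "random_walk G (Suc n) i =
     bind_pmf (pmf_of_set (neighbours G i)) (\<lambda>k. map_pmf ((#) i) (random_walk G n k))"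

text \<open>The probability that the first passage time \<open>min {t \<ge> 1. X\<^sub>t = j}\<close> equals \<open>t\<close>.\<close>

definition first_passage_prob :: "'a ugraph \<Rightarrow> 'a \<Rightarrow> 'a \<Rightarrow> nat \<Rightarrow> real" where
  "first_passage_prob G i j t =
     measure_pmf.prob (random_walk G t i)
       {w. 1 \<le> t \<and> w ! t = j \<and> (\<forall>s. 1 \<le> s \<and> s < t \<longrightarrow> w ! s \<noteq> j)}"

text \<open>
  On a finite connected graph the first passage time is almost surely finite with finite
  expectation, so the series converges and no mass at infinity is ignored.
\<close>

definition mean_first_passage :: "'a ugraph \<Rightarrow> 'a \<Rightarrow> 'a \<Rightarrow> real" where
  "mean_first_passage G i j = (\<Sum>t. real t * first_passage_prob G i j t)"

definition stationary :: "'a ugraph \<Rightarrow> 'a \<Rightarrow> real" where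
  "stationary G j = real (degree G j) / (2 * real (num_edges G))"

definition kemeny_from :: "'a ugraph \<Rightarrow> 'a \<Rightarrow> real" where
  "kemeny_from G i = (\<Sum>j\<in>verts G - {i}. stationary G j * mean_first_passage G i j)"

text \<open>
  Kemeny's constant is the common value of \<open>kemeny_from G i\<close> over all vertices \<open>i\<close>. For a
  single-vertex graph the sum is empty and the value is \<open>0\<close>.
\<close>

definition kemeny :: "'a ugraph \<Rightarrow> real" where
  "kemeny G = (THE k. \<forall>i\<in>verts G. kemeny_from G i = k)"

end

theory Submission
  imports Defs
begin

text \<open>
  The expected hitting times \<open>h\<^sub>j\<close> of \<open>j\<close> solve \<open>L h\<^sub>j = d - 2 m e\<^sub>j\<close>, where \<open>L\<close> is the Laplacian,
  and by the maximum principle this determines them up to a constant. Hence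
  \<open>(h\<^sub>v - h\<^sub>u) / (2 m)\<close> is a potential of the unit current from \<open>u\<close> to \<open>v\<close>, the effective resistance
  is the commute time divided by \<open>2 m\<close>, and \<open>4 m \<kappa> = d\<^sup>T R d\<close>. Across a bridge potentials can be
  glued: \<open>R\<^sub>G\<close> agrees with \<open>R\<^sub>G\<^sub>1\<close> and \<open>R\<^sub>G\<^sub>2\<close> inside the two sides, and
  \<open>R\<^sub>G(u, w) = R\<^sub>G\<^sub>1(u, v\<^sub>1) + 1 + R\<^sub>G\<^sub>2(v\<^sub>2, w)\<close> between them. Splitting the quadratic form accordingly,
  with \<open>d\<^sub>G = d\<^sub>G\<^sub>i + e\<^sub>v\<^sub>i\<close> on the \<open>i\<close>-th side, gives the formula.
\<close>

section \<open>The Laplacian and the maximum principle\<close>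

text \<open>Row \<open>i\<close> of \<open>L f\<close>, written as a net outflow along edges. No
  vertex set occurs, so it adapts easily to subgraphs; \<open>lap_laplacian\<close> links it to the
  matrix.\<close>

definition lap :: "'a ugraph \<Rightarrow> ('a \<Rightarrow> real) \<Rightarrow> 'a \<Rightarrow> real" where
  "lap G f i = (\<Sum>k\<in>neighbours G i. f i - f k)"

section \<open>Laplacian identities and double counting on a finite simple graph\<close>

locale finite_graph =
  fixes G :: "'a ugraph"
  assumes simple: "simple_graph G"
begin

lemma finite_verts: "finite (verts G)"
  using simple by (simp add: simple_graph_def)

lemma edge_verts: "{u, v} \<in> edges G \<Longrightarrow> u \<in> verts G \<and> v \<in> verts G \<and> u \<noteq> v"
  using simple by (force simp: simple_graph_def)

lemma neighbours_subset: "neighbours G v \<subseteq> verts G"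
  using edge_verts by (auto simp: neighbours_def)

lemma finite_neighbours: "finite (neighbours G v)"
  using neighbours_subset finite_verts by (rule finite_subset)

lemma finite_edges: "finite (edges G)"
proof (rule finite_subset)
  show "edges G \<subseteq> Pow (verts G)" using simple by (auto simp: simple_graph_def)
qed (simp add: finite_verts)

lemma sum_neighbours:
  fixes f :: "'a \<Rightarrow> real"
  shows "(\<Sum>k\<in>neighbours G i. f k) = (\<Sum>k\<in>verts G. if {i, k} \<in> edges G then f k else 0)"
proof -
  have "neighbours G i = verts G \<inter> {k. {i, k} \<in> edges G}"
    using neighbours_subset by (auto simp: neighbours_def)
  then show ?thesis by (simp add: sum.inter_restrict[OF finite_verts])
qed

lemma lap_degree: "lap G f i = degree_vec G i * f i - (\<Sum>k\<in>neighbours G i. f k)"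
  by (simp add: lap_def sum_subtractf degree_vec_def degree_def)

lemma lap_laplacian:
  assumes "u \<in> verts G"
  shows "lap G f u = (\<Sum>w\<in>verts G. laplacian G u w * f w)"
proof -
  have "(\<Sum>w\<in>verts G. laplacian G u w * f w) =
      (\<Sum>w\<in>verts G. (if u = w then degree_vec G u * f w else 0)
         - (if {u, w} \<in> edges G then f w else 0))"
    by (rule sum.cong) (auto simp: laplacian_def degree_vec_def algebra_simps)
  also have "\<dots> = lap G f u"
    using assms finite_verts by (simp add: sum_subtractf lap_degree sum_neighbours)
  finally show ?thesis by simp
qed

lemma laplacian_sym: "laplacian G u v = laplacian G v u"
  by (simp add: laplacian_def insert_commute)

text \<open>Discrete Green identity: the matrix \<open>L\<close> is symmetric, so the double sum may
  be read in either order.\<close>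

lemma lap_green: "(\<Sum>u\<in>verts G. g u * lap G f u) = (\<Sum>u\<in>verts G. f u * lap G g u)"
proof -
  have "(\<Sum>u\<in>verts G. g u * lap G f u)
      = (\<Sum>u\<in>verts G. \<Sum>w\<in>verts G. g u * laplacian G u w * f w)"
    by (simp add: lap_laplacian sum_distrib_left mult.assoc)
  also have "\<dots> = (\<Sum>w\<in>verts G. \<Sum>u\<in>verts G. g u * laplacian G u w * f w)"
    by (rule sum.swap)
  also have "\<dots> = (\<Sum>w\<in>verts G. f w * lap G g w)"
    by (auto simp: lap_laplacian sum_distrib_left laplacian_sym mult_ac intro!: sum.cong)
  finally show ?thesis .
qed

lemma lap_const: "lap G (\<lambda>_. c) i = 0"
  by (simp add: lap_def)

lemma sum_lap: "(\<Sum>u\<in>verts G. lap G f u) = 0"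
  using lap_green[of "\<lambda>_. 1" f] by (simp add: lap_const)

lemma lap_diff: "lap G (\<lambda>x. f x - g x) i = lap G f i - lap G g i"
  by (simp add: lap_def sum_subtractf[symmetric] algebra_simps)

lemma lap_cmult: "lap G (\<lambda>x. c * f x) i = c * lap G f i"
  by (simp add: lap_def sum_distrib_left algebra_simps)

lemma lap_divide: "lap G (\<lambda>x. f x / c) i = lap G f i / c"
  by (simp add: lap_def sum_divide_distrib diff_divide_distrib)

lemma lap_sum: "finite A \<Longrightarrow> lap G (\<lambda>x. \<Sum>a\<in>A. f a x) i = (\<Sum>a\<in>A. lap G (f a) i)"
  unfolding lap_def by (subst sum.swap) (simp add: sum_subtractf)

text \<open>An edge at \<open>v\<close> is determined by its other end. This supplies the vertex
  side of the double count in \<open>handshake\<close>.\<close>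

lemma card_incident: "card {e \<in> edges G. v \<in> e} = degree G v"
proof -
  have "bij_betw (\<lambda>u. {v, u}) (neighbours G v) {e \<in> edges G. v \<in> e}"
    unfolding bij_betw_def
  proof
    show "inj_on (\<lambda>u. {v, u}) (neighbours G v)"
      by (auto simp: inj_on_def doubleton_eq_iff)
    show "(\<lambda>u. {v, u}) ` neighbours G v = {e \<in> edges G. v \<in> e}"
    proof (rule Set.set_eqI, rule iffI)
      fix e assume "e \<in> {e \<in> edges G. v \<in> e}"
      then have "e \<in> edges G" "v \<in> e" "card e = 2"
        using simple by (auto simp: simple_graph_def)
      then obtain u where "e = {v, u}"
        by (metis card_2_iff insertE insert_commute singletonD)
      with \<open>e \<in> edges G\<close> show "e \<in> (\<lambda>u. {v, u}) ` neighbours G v"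
        by (auto simp: neighbours_def)
    qed (auto simp: neighbours_def)
  qed
  then show ?thesis by (simp add: degree_def bij_betw_same_card)
qed

lemma handshake: "(\<Sum>v\<in>verts G. degree_vec G v) = 2 * real (num_edges G)"
proof -
  have "(\<Sum>v\<in>verts G. card {e \<in> edges G. v \<in> e}) = 2 * card (edges G)"
  proof (rule sum_multicount[OF finite_verts finite_edges])
    show "\<forall>e\<in>edges G. card {v \<in> verts G. v \<in> e} = 2"
    proof
      fix e assume "e \<in> edges G"
      then have "e \<subseteq> verts G" "card e = 2" using simple by (auto simp: simple_graph_def)
      then show "card {v \<in> verts G. v \<in> e} = 2"
        by (metis Collect_conj_eq Collect_mem_eq inf.absorb_iff2)
    qed
  qed
  then show ?thesis
    by (simp add: card_incident degree_vec_def num_edges_def flip: of_nat_sum)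
qed

end

section \<open>Maximum principle on a connected graph\<close>

locale conn_graph = finite_graph +
  assumes connected: "connected_graph G"
begin

text \<open>Follow a path from \<open>i\<close> to \<open>j\<close>: it can leave \<open>A\<close>
  only from \<open>j\<close>, which is then in \<open>A\<close> already. Exempting \<open>j\<close>
  makes this fit functions harmonic off \<open>j\<close>.\<close>

lemma closed_set_verts:
  assumes "i \<in> verts G" "i \<in> A"
    and closed: "\<And>u v. u \<in> A \<Longrightarrow> v \<in> neighbours G u \<Longrightarrow> v \<in> A \<or> u = j"
    and "j \<in> verts G"
  shows "j \<in> A"
proof -
  have "(i, j) \<in> {(x, y). {x, y} \<in> edges G}\<^sup>*"
    using connected assms(1,4) by (simp add: connected_graph_def reachable_def)
  then show ?thesis
    using \<open>i \<in> A\<close>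
  proof (induction rule: converse_rtrancl_induct)
    case (step y z)
    then have "z \<in> neighbours G y" by (simp add: neighbours_def)
    then have "z \<in> A \<or> y = j" using closed[OF step.prems] by blast
    then show ?case using step.IH step.prems by blast
  qed simp
qed

text \<open>Maximum principle: at a harmonic point where \<open>f\<close> is maximal, the
  nonnegative differences to the neighbours sum to 0, so every neighbour is maximal too. The set of
  maximal points thus propagates until it contains \<open>j\<close>.\<close>

lemma harmonic_le:
  assumes harm: "\<And>i. i \<in> verts G \<Longrightarrow> i \<noteq> j \<Longrightarrow> lap G f i = 0"
    and j: "j \<in> verts G" and i: "i \<in> verts G"
  shows "f i \<le> f j"
proof -
  define M where "M = Max (f ` verts G)"
  have le: "f k \<le> M" if "k \<in> verts G" for k
    unfolding M_def using that finite_verts by simp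
  have "M \<in> f ` verts G"
    unfolding M_def using i finite_verts by (intro Max_in) auto
  then obtain k where k: "k \<in> verts G" "f k = M" by auto
  have "j \<in> {v \<in> verts G. f v = M}"
  proof (rule closed_set_verts[OF k(1) _ _ j])
    fix u v assume u: "u \<in> {v \<in> verts G. f v = M}" and v: "v \<in> neighbours G u"
    show "v \<in> {v \<in> verts G. f v = M} \<or> u = j"
    proof (cases "u = j")
      case False
      then have "(\<Sum>w\<in>neighbours G u. f u - f w) = 0" using harm[of u] u unfolding lap_def by blast
      moreover have "\<forall>w\<in>neighbours G u. 0 \<le> f u - f w"
      proof
        fix w assume "w \<in> neighbours G u"
        then show "0 \<le> f u - f w" using u le[of w] neighbours_subset by fastforce
      qed
      ultimately have "f u - f v = 0"
        using sum_nonneg_eq_0_iff[of "neighbours G u" "\<lambda>w. f u - f w"] finite_neighbours v by blast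
      then show ?thesis using u v neighbours_subset by auto
    qed simp
  qed (use k in auto)
  then show ?thesis using le[OF i] by simp
qed

text \<open>The maximum principle is applied to \<open>f\<close> and to \<open>- f\<close>.\<close>

lemma harmonic_const:
  assumes harm: "\<And>i. i \<in> verts G \<Longrightarrow> i \<noteq> j \<Longrightarrow> lap G f i = 0"
    and j: "j \<in> verts G" and i: "i \<in> verts G"
  shows "f i = f j"
proof (rule antisym)
  show "f i \<le> f j" by (rule harmonic_le[OF assms])
  have "lap G (\<lambda>x. - f x) k = 0" if "k \<in> verts G" "k \<noteq> j" for k
  proof -
    have "(\<lambda>x. - f x) = (\<lambda>x. - 1 * f x)" by simp
    then show ?thesis using harm[OF that] lap_cmult[of "- 1" f k] by (simp only:)
  qed
  then have "- f i \<le> - f j"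
    using harmonic_le[of j "\<lambda>x. - f x" i] j i by blast
  then show "f j \<le> f i" by simp
qed

text \<open>An isolated \<open>i\<close> would make \<open>{i}\<close> a closed set. This ensures
  that \<open>pmf_of_set\<close> in the walk is a genuine uniform distribution.\<close>

lemma neighbours_nonempty:
  assumes "i \<in> verts G" "j \<in> verts G" "i \<noteq> j"
  shows "neighbours G i \<noteq> {}"
proof
  assume "neighbours G i = {}"
  then have "j \<in> {i}" using assms by - (rule closed_set_verts[of i], auto)
  with assms show False by simp
qed

end

section \<open>Hitting times\<close>

lemma random_walk_start: "w \<in> set_pmf (random_walk G n i) \<Longrightarrow> w ! 0 = i"
  by (cases n) auto

lemma measure_bind_pmf:
  "measure_pmf.prob (bind_pmf M f) A = (\<integral>x. measure_pmf.prob (f x) A \<partial>measure_pmf M)"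
  unfolding measure_pmf_bind
  by (rule measure_pmf.measure_bind[where N = "count_space UNIV"])
     (auto simp: space_subprob_algebra subprob_space_measure_pmf)

text \<open>Unlike in \<open>first_passage_prob\<close>, time 0 counts. The walk from
  \<open>j\<close> has then hit already, and the one-step recursion may run through neighbours equal
  to \<open>j\<close>.\<close>

definition hit_prob :: "'a ugraph \<Rightarrow> 'a \<Rightarrow> nat \<Rightarrow> 'a \<Rightarrow> real" where
  "hit_prob G j n i =
     measure_pmf.prob (random_walk G n i) {w. w ! n = j \<and> (\<forall>s<n. w ! s \<noteq> j)}"

lemma hit_prob_nonneg: "0 \<le> hit_prob G j n i"
  by (simp add: hit_prob_def)

lemma hit_prob_0: "hit_prob G j 0 i = (if i = j then 1 else 0)"
  by (simp add: hit_prob_def)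

lemma hit_prob_self: "hit_prob G j (Suc n) j = 0"
  unfolding hit_prob_def measure_pmf_zero_iff using random_walk_start[of _ G "Suc n" j] by blast

text \<open>First-step analysis: condition on the first move.\<close>

lemma (in finite_graph) hit_prob_Suc:
  assumes "neighbours G i \<noteq> {}" "i \<noteq> j"
  shows "hit_prob G j (Suc n) i = (\<Sum>k\<in>neighbours G i. hit_prob G j n k) / degree_vec G i"
proof -
  \<comment> \<open>Prepending \<open>i\<close> shifts all times by one; the new condition at time 0
    is \<open>i \<noteq> j\<close>.\<close>
  have "(#) i -` {w. w ! Suc n = j \<and> (\<forall>s<Suc n. w ! s \<noteq> j)} =
      {w. w ! n = j \<and> (\<forall>s<n. w ! s \<noteq> j)}"
    using assms(2) by (auto simp: All_less_Suc2)
  then show ?thesis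
    using assms(1) finite_neighbours
    by (simp add: hit_prob_def measure_bind_pmf integral_pmf_of_set degree_vec_def degree_def)
qed

lemma first_passage_hit_prob:
  assumes "i \<noteq> j"
  shows "first_passage_prob G i j t = hit_prob G j t i"
proof -
  have "(1 \<le> t \<and> w ! t = j \<and> (\<forall>s. 1 \<le> s \<and> s < t \<longrightarrow> w ! s \<noteq> j)) \<longleftrightarrow>
      (w ! t = j \<and> (\<forall>s<t. w ! s \<noteq> j))" if "w \<in> set_pmf (random_walk G t i)" for w
  proof -
    have "w ! 0 \<noteq> j" using random_walk_start[OF that] assms by blast
    moreover have "1 \<le> s \<or> s = 0" for s :: nat by linarith
    ultimately show ?thesis by metis
  qed
  \<comment> \<open>The events differ as sets of lists, but agree on the support, where entry 0 is
    \<open>i\<close>.\<close>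
  then have *: "{w. 1 \<le> t \<and> w ! t = j \<and> (\<forall>s. 1 \<le> s \<and> s < t \<longrightarrow> w ! s \<noteq> j)} \<inter> set_pmf (random_walk G t i)
     = {w. w ! t = j \<and> (\<forall>s<t. w ! s \<noteq> j)} \<inter> set_pmf (random_walk G t i)"
    by blast
  show ?thesis
    unfolding first_passage_prob_def hit_prob_def
    by (subst measure_Int_set_pmf[symmetric], subst *, rule measure_Int_set_pmf)
qed

text \<open>The tail \<open>P(T > n)\<close> of the hitting time \<open>T\<close> of
  \<open>j\<close> from \<open>i\<close>; a hit at time \<open>n\<close> itself no longer counts as
  survival.\<close>

definition survival :: "'a ugraph \<Rightarrow> 'a \<Rightarrow> nat \<Rightarrow> 'a \<Rightarrow> real" where
  "survival G j n i = 1 - (\<Sum>t\<le>n. hit_prob G j t i)"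

definition hitting_time :: "'a ugraph \<Rightarrow> 'a \<Rightarrow> 'a \<Rightarrow> real" where
  "hitting_time G j i = (\<Sum>t. real t * hit_prob G j t i)"

lemma survival_self: "survival G j n j = 0"
  by (cases n) (simp_all add: survival_def hit_prob_0 hit_prob_self sum.atMost_Suc_shift del: sum.atMost_Suc)

lemma survival_0: "i \<noteq> j \<Longrightarrow> survival G j 0 i = 1"
  by (simp add: survival_def hit_prob_0)

lemma hitting_time_self: "hitting_time G j j = 0"
proof -
  have "(\<lambda>t. real t * hit_prob G j t j) = (\<lambda>_. 0)"
  proof
    fix t show "real t * hit_prob G j t j = 0" by (cases t) (simp_all add: hit_prob_self)
  qed
  then show ?thesis by (simp add: hitting_time_def)
qed

lemma mean_first_passage_eq_hitting_time:
  "i \<noteq> j \<Longrightarrow> mean_first_passage G i j = hitting_time G j i"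
  by (simp add: mean_first_passage_def hitting_time_def first_passage_hit_prob)

text \<open>Summation by parts: a truncated expectation is a sum of tails minus a boundary
  term.\<close>

lemma sum_hit_prob_survival:
  "(\<Sum>t\<le>N. real t * hit_prob G j t i) = (\<Sum>m<N. survival G j m i) - real N * survival G j N i"
proof (induction N)
  case (Suc N)
  have q: "hit_prob G j (Suc N) i = survival G j N i - survival G j (Suc N) i"
    by (simp add: survival_def)
  show ?case by (simp add: Suc q algebra_simps)
qed simp

section \<open>Almost sure hitting, finite expectations and the Poisson equation\<close>

context conn_graph
begin

lemma degree_vec_pos:
  assumes "i \<in> verts G" "j \<in> verts G" "i \<noteq> j"
  shows "degree_vec G i > 0"
  using neighbours_nonempty[OF assms] finite_neighbours
  by (simp add: degree_vec_def degree_def card_gt_0_iff)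

lemma survival_Suc:
  assumes i: "i \<in> verts G" and j: "j \<in> verts G" and ij: "i \<noteq> j"
  shows "survival G j (Suc n) i = (\<Sum>k\<in>neighbours G i. survival G j n k) / degree_vec G i"
proof -
  have "(\<Sum>t\<le>Suc n. hit_prob G j t i) = (\<Sum>t\<le>n. hit_prob G j (Suc t) i)"
    using ij by (simp add: sum.atMost_Suc_shift hit_prob_0 del: sum.atMost_Suc)
  also have "\<dots> = (\<Sum>t\<le>n. \<Sum>k\<in>neighbours G i. hit_prob G j t k) / degree_vec G i"
    using hit_prob_Suc[OF neighbours_nonempty[OF assms] ij] by (simp add: sum_divide_distrib)
  also have "\<dots> = (\<Sum>k\<in>neighbours G i. \<Sum>t\<le>n. hit_prob G j t k) / degree_vec G i"
    by (subst sum.swap) simp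
  finally show ?thesis
    using degree_vec_pos[OF assms]
    by (simp add: survival_def sum_subtractf degree_vec_def degree_def field_simps)
qed

text \<open>The averaging recursion preserves nonnegativity, so disjointness of the hitting events
  need not be argued.\<close>

lemma survival_nonneg:
  assumes "i \<in> verts G" "j \<in> verts G"
  shows "survival G j n i \<ge> 0"
  using assms(1)
proof (induction n arbitrary: i)
  case 0
  then show ?case by (cases "i = j") (simp_all add: survival_self survival_0)
next
  case (Suc n)
  show ?case
  proof (cases "i = j")
    case False
    have "survival G j n k \<ge> 0" if "k \<in> neighbours G i" for k
      using Suc.IH neighbours_subset that by blast
    then show ?thesis
      unfolding survival_Suc[OF Suc.prems assms(2) False]
      by (intro divide_nonneg_nonneg sum_nonneg) (simp_all add: degree_vec_def)
  qed (simp add: survival_self)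
qed

text \<open>The limit of the survival probabilities is harmonic off \<open>j\<close> and vanishes at \<open>j\<close>.\<close>

lemma survival_tendsto_0:
  assumes j: "j \<in> verts G" and i: "i \<in> verts G"
  shows "(\<lambda>n. survival G j n i) \<longlonglongrightarrow> 0"
proof -
  define l where "l = (\<lambda>i. lim (\<lambda>n. survival G j n i))"
  have conv: "(\<lambda>n. survival G j n k) \<longlonglongrightarrow> l k" if k: "k \<in> verts G" for k
  proof -
    have "decseq (\<lambda>n. survival G j n k)"
      unfolding decseq_Suc_iff by (simp add: survival_def hit_prob_nonneg)
    then have "convergent (\<lambda>n. survival G j n k)"
      using survival_nonneg[OF k j] by (metis convergentI decseq_convergent)
    then show ?thesis unfolding l_def by (simp add: convergent_LIMSEQ_iff)
  qed
  have harm: "lap G l k = 0" if k: "k \<in> verts G" "k \<noteq> j" for k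
  proof -
    \<comment> \<open>Passing to the limit on both sides of the averaging recursion makes
      \<open>l\<close> harmonic at \<open>k\<close>.\<close>
    have "(\<lambda>n. survival G j (Suc n) k) \<longlonglongrightarrow> l k"
      using conv[OF k(1)] by (rule LIMSEQ_Suc)
    moreover have "(\<lambda>n. survival G j (Suc n) k) \<longlonglongrightarrow> (\<Sum>x\<in>neighbours G k. l x) / degree_vec G k"
      unfolding survival_Suc[OF k(1) j k(2)]
      using degree_vec_pos[OF k(1) j k(2)] neighbours_subset
      by (intro tendsto_divide tendsto_sum conv) auto
    ultimately have "l k = (\<Sum>x\<in>neighbours G k. l x) / degree_vec G k"
      by (rule LIMSEQ_unique)
    then show ?thesis
      using degree_vec_pos[OF k(1) j k(2)] by (simp add: lap_degree field_simps)
  qed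
  have "l j = 0" by (simp add: l_def survival_self)
  moreover have "l i = l j" by (rule harmonic_const[OF harm j i])
  ultimately show ?thesis using conv[OF i] by simp
qed

text \<open>If \<open>n\<close> is so large that \<open>j\<close> is hit by time \<open>n\<close> with probability at least a half from every
  vertex, then twice the expected hitting time truncated at \<open>n\<close> is a superharmonic majorant.\<close>

lemma sum_survival_bounded:
  assumes j: "j \<in> verts G" and i: "i \<in> verts G"
  shows "\<exists>B. \<forall>N. (\<Sum>m<N. survival G j m i) \<le> B"
proof -
  \<comment> \<open>Finiteness of the vertex set makes one \<open>n\<close> work for all starting
    vertices.\<close>
  have "\<forall>\<^sub>F n in sequentially. \<forall>k\<in>verts G. survival G j n k < 1 / 2"
    using finite_verts
  proof (rule eventually_ball_finite, intro ballI)
    fix k assume "k \<in> verts G"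
    then show "\<forall>\<^sub>F n in sequentially. survival G j n k < 1 / 2"
      by (rule order_tendstoD(2)[OF survival_tendsto_0[OF j]]) simp
  qed
  then obtain n where n: "\<And>k. k \<in> verts G \<Longrightarrow> survival G j n k < 1 / 2"
    unfolding eventually_sequentially by blast
  define g where "g k = 2 * (\<Sum>m<n. survival G j m k)" for k
  have avg: "(\<Sum>m<N. survival G j (Suc m) k) =
      (\<Sum>x\<in>neighbours G k. \<Sum>m<N. survival G j m x) / degree_vec G k"
    if "k \<in> verts G" "k \<noteq> j" for k N
  proof -
    have "(\<Sum>m<N. survival G j (Suc m) k) =
      (\<Sum>m<N. \<Sum>x\<in>neighbours G k. survival G j m x) / degree_vec G k"
      by (simp add: survival_Suc[OF that(1) j that(2)] sum_divide_distrib)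
    then show ?thesis by (subst sum.swap)
  qed
  have "(\<Sum>m<N. survival G j m k) \<le> g k" if "k \<in> verts G" for N k
    using that
  proof (induction N arbitrary: k)
    case 0
    then show ?case using survival_nonneg[OF _ j] by (simp add: g_def sum_nonneg)
  next
    case (Suc N)
    show ?case
    proof (cases "k = j")
      case False
      have "(\<Sum>m<Suc N. survival G j m k) = 1 + (\<Sum>m<N. survival G j (Suc m) k)"
        using False by (simp add: sum.lessThan_Suc_shift survival_0 del: sum.lessThan_Suc)
      also have "\<dots> = 1 + (\<Sum>x\<in>neighbours G k. \<Sum>m<N. survival G j m x) / degree_vec G k"
        by (simp add: avg[OF Suc.prems False])
      also have "\<dots> \<le> 1 + (\<Sum>x\<in>neighbours G k. g x) / degree_vec G k"
      proof (intro add_left_mono divide_right_mono sum_mono)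
        fix x assume "x \<in> neighbours G k"
        then show "(\<Sum>m<N. survival G j m x) \<le> g x" using Suc.IH neighbours_subset by blast
      qed (simp add: degree_vec_def)
      also have "\<dots> = 1 + 2 * (\<Sum>m<n. survival G j (Suc m) k)"
        by (simp add: avg[OF Suc.prems False] g_def sum_distrib_left)
      also have "(\<Sum>m<n. survival G j (Suc m) k) =
          (\<Sum>m<n. survival G j m k) + survival G j n k - survival G j 0 k"
        using sum.lessThan_Suc_shift[of "\<lambda>m. survival G j m k" n] by simp
      \<comment> \<open>As \<open>survival G j 0 k\<close> is 1, the left side equals
        \<open>g k - 1 + 2 * survival G j n k\<close>. The factor 2 in \<open>g\<close> is matched
        to the bound 1/2.\<close>
      also have "1 + 2 * \<dots> \<le> g k"
        using n[OF Suc.prems] False by (simp add: g_def survival_0)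
      finally show ?thesis .
    qed (simp add: survival_self g_def)
  qed
  then show ?thesis using i by blast
qed

text \<open>The boundary term of the summation by parts is nonnegative, so the bounded tail sums
  dominate all partial sums.\<close>

lemma summable_hitting_time:
  assumes j: "j \<in> verts G" and i: "i \<in> verts G"
  shows "summable (\<lambda>t. real t * hit_prob G j t i)"
proof -
  obtain B where B: "\<And>N. (\<Sum>m<N. survival G j m i) \<le> B"
    using sum_survival_bounded[OF assms] by blast
  show ?thesis
  proof (rule bounded_imp_summable)
    fix N
    show "(\<Sum>t\<le>N. real t * hit_prob G j t i) \<le> B"
    proof -
      have "0 \<le> real N * survival G j N i" using survival_nonneg[OF i j] by simp
      then show ?thesis unfolding sum_hit_prob_survival using B[of N] by linarith
    qed
  qed (simp add: hit_prob_nonneg)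
qed

lemma hit_prob_sums:
  assumes j: "j \<in> verts G" and i: "i \<in> verts G"
  shows "(\<lambda>t. hit_prob G j t i) sums 1"
proof -
  have "(\<lambda>n. 1 - survival G j n i) \<longlonglongrightarrow> 1 - 0"
    by (intro tendsto_intros survival_tendsto_0 assms)
  then show ?thesis by (simp add: survival_def sums_def_le)
qed

text \<open>First-step equation: \<open>h i\<close> is 1 plus the average of \<open>h\<close> over
  the neighbours of \<open>i\<close>; multiplying by the degree gives the claim.\<close>

lemma lap_hitting_time:
  assumes j: "j \<in> verts G" and i: "i \<in> verts G" and ij: "i \<noteq> j"
  shows "lap G (hitting_time G j) i = degree_vec G i"
proof -
  have sums: "(\<lambda>t. real t * hit_prob G j t k) sums hitting_time G j k" if "k \<in> verts G" for k
    unfolding hitting_time_def using summable_hitting_time[OF j that] by (rule summable_sums)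
  \<comment> \<open>The term at \<open>t = 0\<close> carries the factor 0, so the index shift keeps
    the sum.\<close>
  have "(\<lambda>t. real (Suc t) * hit_prob G j (Suc t) i) sums hitting_time G j i"
    using sums[OF i] by (subst sums_Suc_iff) simp
  \<comment> \<open>Split \<open>Suc t\<close> as \<open>t + 1\<close>: the first part sums to the
    hitting time from \<open>k\<close>, the second to total mass 1.\<close>
  moreover have "real (Suc t) * hit_prob G j (Suc t) i =
      (\<Sum>k\<in>neighbours G i. real t * hit_prob G j t k + hit_prob G j t k) / degree_vec G i" for t
    unfolding hit_prob_Suc[OF neighbours_nonempty[OF i j ij] ij]
    by (simp add: sum_distrib_left algebra_simps sum.distrib add_divide_distrib)
  moreover have "(\<lambda>t. (\<Sum>k\<in>neighbours G i. real t * hit_prob G j t k + hit_prob G j t k) / degree_vec G i)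
      sums ((\<Sum>k\<in>neighbours G i. hitting_time G j k + 1) / degree_vec G i)"
    using neighbours_subset by (intro sums_divide sums_sum sums_add sums hit_prob_sums j) auto
  ultimately have "hitting_time G j i = (\<Sum>k\<in>neighbours G i. hitting_time G j k + 1) / degree_vec G i"
    using sums_unique2 by simp
  then show ?thesis
    using degree_vec_pos[OF i j ij]
    by (simp add: lap_degree sum.distrib field_simps) (simp add: degree_vec_def degree_def)
qed

text \<open>The Laplacian of any function sums to 0, so the values off \<open>j\<close> force the
  one at \<open>j\<close>.\<close>

lemma lap_hitting_time_self:
  assumes j: "j \<in> verts G"
  shows "lap G (hitting_time G j) j = degree_vec G j - 2 * real (num_edges G)"
proof -
  have "0 = lap G (hitting_time G j) j + (\<Sum>i\<in>verts G - {j}. degree_vec G i)"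
    using sum_lap[of "hitting_time G j"] j
    by (simp add: sum.remove[OF finite_verts j] lap_hitting_time)
  moreover have "2 * real (num_edges G) = degree_vec G j + (\<Sum>i\<in>verts G - {j}. degree_vec G i)"
    by (simp add: sum.remove[OF finite_verts j] flip: handshake)
  ultimately show ?thesis by simp
qed

lemma lap_hitting_time_eq:
  assumes "j \<in> verts G" "i \<in> verts G"
  shows "lap G (hitting_time G j) i = degree_vec G i - 2 * real (num_edges G) * basis_vec j i"
  using assms by (simp add: basis_vec_def lap_hitting_time lap_hitting_time_self)

section \<open>Kemeny's constant through hitting times\<close>

lemma degree_vec_no_edges:
  assumes "num_edges G = 0"
  shows "degree_vec G i = 0"
proof -
  have "edges G = {}" using assms finite_edges by (simp add: num_edges_def)
  then show ?thesis by (simp add: degree_vec_def degree_def neighbours_def)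
qed

text \<open>The term \<open>j = i\<close> may be included because \<open>hitting_time G i i\<close>
  is 0.\<close>

lemma kemeny_from_hitting_time:
  "kemeny_from G i = (\<Sum>j\<in>verts G. stationary G j * hitting_time G j i)"
proof -
  have "kemeny_from G i = (\<Sum>j\<in>verts G - {i}. stationary G j * hitting_time G j i)"
    unfolding kemeny_from_def by (rule sum.cong) (auto simp: mean_first_passage_eq_hitting_time)
  also have "\<dots> = (\<Sum>j\<in>verts G. stationary G j * hitting_time G j i)"
    using finite_verts by (intro sum.mono_neutral_left) (auto simp: hitting_time_self)
  finally show ?thesis .
qed

text \<open>Weighting \<open>L h_j = d - 2 m e_j\<close> by the stationary distribution gives
  \<open>d - d = 0\<close>, so the function is harmonic everywhere.\<close>

lemma kemeny_from_const:
  assumes "i \<in> verts G" "k \<in> verts G"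
  shows "kemeny_from G i = kemeny_from G k"
proof (rule harmonic_const[OF _ assms(2,1)])
  fix u assume u: "u \<in> verts G"
  have "lap G (kemeny_from G) u = (\<Sum>j\<in>verts G. stationary G j * lap G (hitting_time G j) u)"
    by (simp add: kemeny_from_hitting_time[abs_def] lap_sum[OF finite_verts] lap_cmult)
  also have "\<dots> = degree_vec G u * (\<Sum>j\<in>verts G. stationary G j)
      - 2 * real (num_edges G) * (\<Sum>j\<in>verts G. if u = j then stationary G j else 0)"
  proof -
    have "stationary G j * lap G (hitting_time G j) u = degree_vec G u * stationary G j
        - 2 * real (num_edges G) * (if u = j then stationary G j else 0)" if "j \<in> verts G" for j
      using u that by (simp add: lap_hitting_time_eq basis_vec_def algebra_simps)
    then show ?thesis by (simp add: sum_subtractf sum_distrib_left)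
  qed
  also have "(\<Sum>j\<in>verts G. stationary G j) = (\<Sum>j\<in>verts G. degree_vec G j) / (2 * real (num_edges G))"
    by (simp add: stationary_def sum_divide_distrib degree_vec_def)
  \<comment> \<open>Without edges the stationary weights are quotients by 0, but both terms vanish
    since their other factors do.\<close>
  also have "degree_vec G u * \<dots> - 2 * real (num_edges G) * (\<Sum>j\<in>verts G. if u = j then stationary G j else 0) = 0"
    using u finite_verts degree_vec_no_edges[of u] unfolding handshake
    by (cases "num_edges G = 0") (simp_all add: stationary_def degree_vec_def)
  finally show "lap G (kemeny_from G) u = 0" .
qed

lemma kemeny_eq:
  assumes "i \<in> verts G"
  shows "kemeny G = kemeny_from G i"
  unfolding kemeny_def
proof (rule the_equality)
  show "\<forall>k\<in>verts G. kemeny_from G k = kemeny_from G i"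
    using kemeny_from_const assms by blast
qed (use assms in auto)

end

section \<open>Effective resistance\<close>

lemma mat_eq_on_trans [trans]: "mat_eq_on V A B \<Longrightarrow> mat_eq_on V B C \<Longrightarrow> mat_eq_on V A C"
  by (simp add: mat_eq_on_def)

lemma mat_eq_on_sym: "mat_eq_on V A B \<Longrightarrow> mat_eq_on V B A"
  by (simp add: mat_eq_on_def)

lemma mat_eq_on_refl: "mat_eq_on V A A"
  by (simp add: mat_eq_on_def)

lemma mat_eq_on_transpose:
  "mat_eq_on V A B \<Longrightarrow> mat_eq_on V (mat_transpose A) (mat_transpose B)"
  by (simp add: mat_eq_on_def mat_transpose_def)

lemma mat_mult_on_cong:
  "mat_eq_on V A A' \<Longrightarrow> mat_eq_on V B B' \<Longrightarrow> mat_eq_on V (mat_mult_on V A B) (mat_mult_on V A' B')"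
  by (simp add: mat_eq_on_def mat_mult_on_def)

lemma mat_mult_on_assoc:
  "mat_mult_on V (mat_mult_on V A B) C = mat_mult_on V A (mat_mult_on V B C)"
proof (intro ext)
  fix u w
  have "(\<Sum>x\<in>V. (\<Sum>y\<in>V. A u y * B y x) * C x w) = (\<Sum>x\<in>V. \<Sum>y\<in>V. A u y * (B y x * C x w))"
    by (simp add: sum_distrib_right mult.assoc)
  also have "\<dots> = (\<Sum>y\<in>V. A u y * (\<Sum>x\<in>V. B y x * C x w))"
    by (subst sum.swap) (simp add: sum_distrib_left)
  finally show "mat_mult_on V (mat_mult_on V A B) C u w = mat_mult_on V A (mat_mult_on V B C) u w"
    by (simp add: mat_mult_on_def)
qed

lemma mat_transpose_mult_on:
  "mat_transpose (mat_mult_on V A B) = mat_mult_on V (mat_transpose B) (mat_transpose A)"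
  by (simp add: mat_transpose_def mat_mult_on_def mult.commute)

lemma symmetric_mat_mult_transpose:
  assumes P: "mat_eq_on V (mat_transpose P) P" and Q: "mat_eq_on V (mat_transpose Q) Q"
  shows "mat_eq_on V (mat_mult_on V P Q) (mat_transpose (mat_mult_on V Q P))"
  unfolding mat_transpose_mult_on
  by (rule mat_mult_on_cong[OF mat_eq_on_sym[OF P] mat_eq_on_sym[OF Q]])

text \<open>The symmetry conditions give \<open>A Y = A X\<close> and \<open>X A = Y A\<close>; then
  \<open>X = X A X = Y A X = Y A Y = Y\<close>.\<close>

lemma moore_penrose_unique:
  assumes X: "is_moore_penrose_on V A X" and Y: "is_moore_penrose_on V A Y"
  shows "X = Y"
proof -
  have AXA: "mat_eq_on V (mat_mult_on V (mat_mult_on V A X) A) A"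
    and XAX: "mat_eq_on V (mat_mult_on V (mat_mult_on V X A) X) X"
    and AX: "mat_eq_on V (mat_transpose (mat_mult_on V A X)) (mat_mult_on V A X)"
    and XA: "mat_eq_on V (mat_transpose (mat_mult_on V X A)) (mat_mult_on V X A)"
    using X by (auto simp: is_moore_penrose_on_def)
  have AYA: "mat_eq_on V (mat_mult_on V (mat_mult_on V A Y) A) A"
    and YAY: "mat_eq_on V (mat_mult_on V (mat_mult_on V Y A) Y) Y"
    and AY: "mat_eq_on V (mat_transpose (mat_mult_on V A Y)) (mat_mult_on V A Y)"
    and YA: "mat_eq_on V (mat_transpose (mat_mult_on V Y A)) (mat_mult_on V Y A)"
    using Y by (auto simp: is_moore_penrose_on_def)
  \<comment> \<open>\<open>A Y = (A X)(A Y)\<close>, which by symmetry is the transpose of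
    \<open>(A Y)(A X) = A X\<close>.\<close>
  have "mat_eq_on V (mat_mult_on V A Y) (mat_mult_on V (mat_mult_on V A X) (mat_mult_on V A Y))"
    using mat_mult_on_cong[OF mat_eq_on_sym[OF AXA] mat_eq_on_refl[of V Y]]
    by (simp add: mat_mult_on_assoc)
  also have "mat_eq_on V \<dots> (mat_transpose (mat_mult_on V (mat_mult_on V A Y) (mat_mult_on V A X)))"
    by (rule symmetric_mat_mult_transpose[OF AX AY])
  also have "mat_eq_on V \<dots> (mat_transpose (mat_mult_on V A X))"
    using mat_eq_on_transpose[OF mat_mult_on_cong[OF AYA mat_eq_on_refl[of V X]]]
    by (simp add: mat_mult_on_assoc)
  also note AX
  finally have eq1: "mat_eq_on V (mat_mult_on V A Y) (mat_mult_on V A X)" .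
  have "mat_eq_on V (mat_mult_on V X A) (mat_mult_on V (mat_mult_on V X A) (mat_mult_on V Y A))"
    using mat_mult_on_cong[OF mat_eq_on_refl[of V X] mat_eq_on_sym[OF AYA]]
    by (simp add: mat_mult_on_assoc)
  also have "mat_eq_on V \<dots> (mat_transpose (mat_mult_on V (mat_mult_on V Y A) (mat_mult_on V X A)))"
    by (rule symmetric_mat_mult_transpose[OF XA YA])
  also have "mat_eq_on V \<dots> (mat_transpose (mat_mult_on V Y A))"
    using mat_eq_on_transpose[OF mat_mult_on_cong[OF mat_eq_on_refl[of V Y] AXA]]
    by (simp add: mat_mult_on_assoc)
  also note YA
  finally have eq2: "mat_eq_on V (mat_mult_on V X A) (mat_mult_on V Y A)" .
  have "mat_eq_on V X (mat_mult_on V (mat_mult_on V X A) X)"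
    by (rule mat_eq_on_sym[OF XAX])
  also have "mat_eq_on V \<dots> (mat_mult_on V (mat_mult_on V Y A) X)"
    by (rule mat_mult_on_cong[OF eq2 mat_eq_on_refl])
  also have "mat_eq_on V \<dots> (mat_mult_on V (mat_mult_on V Y A) Y)"
    unfolding mat_mult_on_assoc by (rule mat_mult_on_cong[OF mat_eq_on_refl mat_eq_on_sym[OF eq1]])
  also note YAY
  finally have "mat_eq_on V X Y" .
  then have inside: "X u v = Y u v" if "u \<in> V \<and> v \<in> V" for u v
    using that by (simp add: mat_eq_on_def)
  \<comment> \<open>The convention on entries outside \<open>V\<close> turns equality on
    \<open>V\<close> into equality of functions.\<close>
  have outside: "X u v = 0" "Y u v = 0" if "\<not> (u \<in> V \<and> v \<in> V)" for u v
    using X Y that unfolding is_moore_penrose_on_def by blast+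
  show ?thesis
  proof (intro ext)
    fix u v show "X u v = Y u v"
      by (cases "u \<in> V \<and> v \<in> V") (simp_all only: inside outside not_False_eq_True)
  qed
qed

section \<open>The pseudoinverse of the Laplacian and effective resistance\<close>

context conn_graph
begin

lemma num_edges_pos:
  assumes "u \<in> verts G" "v \<in> verts G" "u \<noteq> v"
  shows "num_edges G > 0"
  using degree_vec_pos[OF assms] degree_vec_no_edges[of u] by (cases "num_edges G = 0") auto

text \<open>In the difference of the Poisson equations for \<open>v\<close> and \<open>u\<close> the
  degrees cancel. For \<open>u = v\<close> the function is 0, which also covers the edgeless
  graph.\<close>

lemma lap_commute_potential:
  assumes "u \<in> verts G" "v \<in> verts G" "x \<in> verts G"
  shows "lap G (\<lambda>y. (hitting_time G v y - hitting_time G u y) / (2 * real (num_edges G))) x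
    = basis_vec u x - basis_vec v x"
proof (cases "u = v")
  case False
  then have "num_edges G > 0" using num_edges_pos assms by blast
  then show ?thesis
    using assms by (simp add: lap_divide lap_diff lap_hitting_time_eq field_simps)
qed (simp add: lap_const)

text \<open>Averaging the unit-current potentials from \<open>v\<close> to \<open>w\<close> over all
  sinks \<open>w\<close> spreads the sink uniformly; subtracting the mean normalises the
  result.\<close>

lemma poisson_solution:
  assumes v: "v \<in> verts G"
  obtains f where "\<And>u. u \<in> verts G \<Longrightarrow> lap G f u = basis_vec v u - 1 / real (card (verts G))"
    and "(\<Sum>x\<in>verts G. f x) = 0"
proof -
  define n where "n = real (card (verts G))"
  have n: "n > 0" using v finite_verts by (auto simp: n_def card_gt_0_iff)
  define F where "F w y = (hitting_time G w y - hitting_time G v y) / (2 * real (num_edges G))" for w y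
  define g where "g y = (\<Sum>w\<in>verts G. F w y) / n" for y
  define c where "c = (\<Sum>x\<in>verts G. g x) / n"
  show thesis
  proof (rule that[of "\<lambda>x. g x - c"])
    fix u assume u: "u \<in> verts G"
    have "lap G (\<lambda>x. g x - c) u = (\<Sum>w\<in>verts G. lap G (F w) u) / n"
      unfolding lap_diff lap_const g_def lap_divide lap_sum[OF finite_verts] by simp
    also have "(\<Sum>w\<in>verts G. lap G (F w) u) = (\<Sum>w\<in>verts G. basis_vec v u - (if u = w then 1 else 0))"
      unfolding F_def using lap_commute_potential[OF v _ u]
      by (intro sum.cong) (auto simp: basis_vec_def)
    also have "\<dots> / n = basis_vec v u - 1 / n"
      using n u finite_verts by (auto simp: sum_subtractf n_def diff_divide_distrib)
    finally show "lap G (\<lambda>x. g x - c) u = basis_vec v u - 1 / real (card (verts G))"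
      by (simp add: n_def)
  next
    show "(\<Sum>x\<in>verts G. g x - c) = 0"
      using n by (simp add: sum_subtractf c_def flip: n_def)
  qed
qed

text \<open>The columns are the zero-sum Poisson solutions. Both \<open>L X\<close> and
  \<open>X L\<close> are then the projection \<open>I - J / n\<close> onto zero-sum vectors
  (\<open>J\<close> all ones), from which the Penrose equations follow.\<close>

lemma moore_penrose_laplacian:
  obtains X where "moore_penrose_on (verts G) (laplacian G) = X"
    and "\<And>u v. X u v = X v u"
    and "\<And>u v. u \<in> verts G \<Longrightarrow> v \<in> verts G \<Longrightarrow>
      lap G (X v) u = basis_vec v u - 1 / real (card (verts G))"
proof -
  let ?V = "verts G" and ?L = "laplacian G" and ?n = "real (card (verts G))"
  have "\<forall>v\<in>?V. \<exists>f. (\<forall>u\<in>?V. lap G f u = basis_vec v u - 1 / ?n) \<and> (\<Sum>x\<in>?V. f x) = 0"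
    using poisson_solution by metis
  then obtain Y where Y: "\<And>u v. u \<in> ?V \<Longrightarrow> v \<in> ?V \<Longrightarrow> lap G (Y v) u = basis_vec v u - 1 / ?n"
    and Y0: "\<And>v. v \<in> ?V \<Longrightarrow> (\<Sum>x\<in>?V. Y v x) = 0"
    by metis
  \<comment> \<open>Pairing with \<open>Y v\<close> kills the constant part because
    \<open>Y v\<close> sums to 0. Green's identity then makes \<open>Y\<close> symmetric.\<close>
  have green: "(\<Sum>x\<in>?V. Y v x * lap G (Y u) x) = Y v u" if "u \<in> ?V" "v \<in> ?V" for u v
  proof -
    have "(\<Sum>x\<in>?V. Y v x * lap G (Y u) x)
        = (\<Sum>x\<in>?V. (if x = u then Y v x else 0) - Y v x / ?n)"
      using that by (intro sum.cong) (simp_all add: Y basis_vec_def algebra_simps)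
    also have "\<dots> = Y v u - (\<Sum>x\<in>?V. Y v x) / ?n"
      using that finite_verts by (simp add: sum_subtractf sum_divide_distrib)
    finally show ?thesis using Y0 that by simp
  qed
  define X where "X u v = (if u \<in> ?V \<and> v \<in> ?V then Y u v else 0)" for u v
  have sym: "X u v = X v u" for u v
    using green[of u v] green[of v u] lap_green[of "Y v" "Y u"] by (auto simp: X_def)
  have lapX: "lap G (X v) u = basis_vec v u - 1 / ?n" if "u \<in> ?V" "v \<in> ?V" for u v
  proof -
    have "lap G (X v) u = lap G (Y v) u"
      unfolding lap_def using that neighbours_subset by (intro sum.cong) (auto simp: X_def)
    then show ?thesis using Y that by simp
  qed
  have sumX: "(\<Sum>x\<in>?V. X v x) = 0" if "v \<in> ?V" for v
    using Y0[OF that] that by (simp add: X_def)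
  have LX: "mat_mult_on ?V ?L X u v = basis_vec v u - 1 / ?n" if "u \<in> ?V" "v \<in> ?V" for u v
    using lapX[OF that] lap_laplacian[OF that(1), of "X v"] by (simp add: mat_mult_on_def sym)
  have XL: "mat_mult_on ?V X ?L u v = basis_vec v u - 1 / ?n" if "u \<in> ?V" "v \<in> ?V" for u v
    using LX[OF that(2,1)]
    by (simp add: mat_mult_on_def sym laplacian_sym mult.commute basis_vec_def)
  \<comment> \<open>The projection subtracts the mean, so it fixes the zero-sum columns of
    \<open>L\<close> and \<open>X\<close>.\<close>
  have row: "(\<Sum>x\<in>?V. (basis_vec x u - 1 / ?n) * A x) = A u - (\<Sum>x\<in>?V. A x) / ?n"
    if "u \<in> ?V" for u and A :: "'a \<Rightarrow> real"
  proof -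
    have "(\<Sum>x\<in>?V. (basis_vec x u - 1 / ?n) * A x) = (\<Sum>x\<in>?V. (if u = x then A x else 0) - A x / ?n)"
      by (intro sum.cong) (simp_all add: basis_vec_def algebra_simps)
    then show ?thesis using that finite_verts by (simp add: sum_subtractf sum_divide_distrib)
  qed
  have sumL: "(\<Sum>x\<in>?V. ?L x w) = 0" if "w \<in> ?V" for w
    using lap_laplacian[OF that, of "\<lambda>_. 1"] by (simp add: lap_const laplacian_sym)
  have mp: "is_moore_penrose_on ?V ?L X"
    unfolding is_moore_penrose_on_def mat_eq_on_def
  proof (intro conjI ballI allI impI)
    fix u w assume uw: "u \<in> ?V" "w \<in> ?V"
    have "mat_mult_on ?V (mat_mult_on ?V ?L X) ?L u w = (\<Sum>x\<in>?V. (basis_vec x u - 1 / ?n) * ?L x w)"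
      unfolding mat_mult_on_def[of ?V "mat_mult_on ?V ?L X"]
      by (intro sum.cong refl) (simp add: LX uw)
    then show "mat_mult_on ?V (mat_mult_on ?V ?L X) ?L u w = ?L u w"
      using uw by (simp add: row sumL)
    have "mat_mult_on ?V (mat_mult_on ?V X ?L) X u w = (\<Sum>x\<in>?V. (basis_vec x u - 1 / ?n) * X x w)"
      unfolding mat_mult_on_def[of ?V "mat_mult_on ?V X ?L"]
      by (intro sum.cong refl) (simp add: XL uw)
    also have "\<dots> = X u w - (\<Sum>x\<in>?V. X w x) / ?n"
      using uw by (simp add: row sym[of _ w])
    finally show "mat_mult_on ?V (mat_mult_on ?V X ?L) X u w = X u w"
      using uw by (simp add: sumX)
    show "mat_transpose (mat_mult_on ?V ?L X) u w = mat_mult_on ?V ?L X u w"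
      "mat_transpose (mat_mult_on ?V X ?L) u w = mat_mult_on ?V X ?L u w"
      using uw by (simp_all add: mat_transpose_def LX XL basis_vec_def)
  next
    fix u w assume "u \<notin> ?V \<or> w \<notin> ?V"
    then show "X u w = 0" by (auto simp: X_def)
  qed
  have "moore_penrose_on ?V ?L = X"
    unfolding moore_penrose_on_def
    by (rule the_equality[where P = "is_moore_penrose_on ?V ?L", OF mp moore_penrose_unique[OF _ mp]])
  then show thesis by (rule that[OF _ sym lapX])
qed

text \<open>Any potential of the unit current computes the resistance: the pseudoinverse applied to
  \<open>L f\<close> returns \<open>f\<close> up to its mean, and the mean cancels in the
  difference.\<close>

lemma resistance_potential:
  assumes u: "u \<in> verts G" and v: "v \<in> verts G"
    and f: "\<And>x. x \<in> verts G \<Longrightarrow> lap G f x = basis_vec u x - basis_vec v x"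
  shows "resistance_matrix G u v = f u - f v"
proof -
  let ?V = "verts G" and ?b = "\<lambda>x. basis_vec u x - basis_vec v x"
  obtain X where X: "moore_penrose_on ?V (laplacian G) = X"
    and sym: "\<And>u v. X u v = X v u"
    and lapX: "\<And>u v. u \<in> ?V \<Longrightarrow> v \<in> ?V \<Longrightarrow> lap G (X v) u = basis_vec v u - 1 / real (card ?V)"
    using moore_penrose_laplacian by blast
  define c where "c = (\<Sum>y\<in>?V. f y) / real (card ?V)"
  have inner: "(\<Sum>y\<in>?V. X x y * ?b y) = f x - c" if x: "x \<in> ?V" for x
  proof -
    have "(\<Sum>y\<in>?V. X x y * ?b y) = (\<Sum>y\<in>?V. X x y * lap G f y)"
      by (intro sum.cong) (simp_all add: f)
    also have "\<dots> = (\<Sum>y\<in>?V. f y * lap G (X x) y)" by (rule lap_green)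
    also have "\<dots> = (\<Sum>y\<in>?V. (if y = x then f y else 0) - f y / real (card ?V))"
      using x by (intro sum.cong) (simp_all add: lapX basis_vec_def algebra_simps)
    also have "\<dots> = f x - c"
      using x finite_verts by (simp add: sum_subtractf c_def sum_divide_distrib)
    finally show ?thesis .
  qed
  have "resistance_matrix G u v = (\<Sum>x\<in>?V. ?b x * (\<Sum>y\<in>?V. X x y * ?b y))"
    by (simp add: resistance_matrix_def vec_mat_vec_def X sum_distrib_left mult.assoc)
  also have "\<dots> = (\<Sum>x\<in>?V. ?b x * (f x - c))"
    using inner by (intro sum.cong) simp_all
  also have "\<dots> = (\<Sum>x\<in>?V. (if x = u then f x - c else 0) - (if x = v then f x - c else 0))"
    by (intro sum.cong) (simp_all add: basis_vec_def)
  also have "\<dots> = f u - f v"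
    using u v finite_verts by (simp add: sum_subtractf)
  finally show ?thesis .
qed

text \<open>Commute-time identity: evaluate the potential at its two poles, where one hitting time
  each is 0.\<close>

lemma resistance_commute_time:
  assumes "u \<in> verts G" "v \<in> verts G"
  shows "resistance_matrix G u v =
    (hitting_time G v u + hitting_time G u v) / (2 * real (num_edges G))"
  using resistance_potential[OF assms lap_commute_potential[OF assms]]
  by (simp add: hitting_time_self diff_divide_distrib add_divide_distrib)

lemma resistance_sym:
  assumes "u \<in> verts G" "v \<in> verts G"
  shows "resistance_matrix G u v = resistance_matrix G v u"
  using assms by (simp add: resistance_commute_time add.commute)

text \<open>Substitute commute times for \<open>R\<close>. Exchanging \<open>i\<close> and
  \<open>j\<close> identifies the two halves, and each is a degree-weighted sum of a quantity
  constant in the starting vertex. Without edges both sides are 0.\<close>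

lemma kemeny_resistance:
  "4 * real (num_edges G) * kemeny G =
    vec_mat_vec (verts G) (degree_vec G) (resistance_matrix G) (degree_vec G)"
proof (cases "num_edges G = 0")
  case True
  then show ?thesis by (simp add: vec_mat_vec_def degree_vec_no_edges)
next
  case False
  let ?V = "verts G" and ?d = "degree_vec G" and ?m = "real (num_edges G)" and ?h = "hitting_time G"
  have m: "?m > 0" using False by simp
  have kem: "(\<Sum>j\<in>?V. ?d j * ?h j i) = 2 * ?m * kemeny G" if "i \<in> ?V" for i
    using m by (simp add: kemeny_eq[OF that] kemeny_from_hitting_time stationary_def degree_vec_def
        sum_distrib_left)
  have half: "(\<Sum>i\<in>?V. ?d i * (\<Sum>j\<in>?V. ?d j * ?h j i)) = 4 * ?m\<^sup>2 * kemeny G"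
  proof -
    have "(\<Sum>i\<in>?V. ?d i * (\<Sum>j\<in>?V. ?d j * ?h j i)) = (\<Sum>i\<in>?V. ?d i) * (2 * ?m * kemeny G)"
      by (simp add: kem sum_distrib_right)
    then show ?thesis by (simp add: handshake power2_eq_square)
  qed
  have "vec_mat_vec ?V ?d (resistance_matrix G) ?d =
      (\<Sum>i\<in>?V. \<Sum>j\<in>?V. (?d i * (?d j * ?h j i) + ?d j * (?d i * ?h i j)) / (2 * ?m))"
    unfolding vec_mat_vec_def
    by (intro sum.cong refl) (simp add: resistance_commute_time field_simps)
  also have "\<dots> = ((\<Sum>i\<in>?V. ?d i * (\<Sum>j\<in>?V. ?d j * ?h j i))
      + (\<Sum>i\<in>?V. \<Sum>j\<in>?V. ?d j * (?d i * ?h i j))) / (2 * ?m)"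
    by (simp add: sum.distrib sum_distrib_left flip: sum_divide_distrib)
  also have "(\<Sum>i\<in>?V. \<Sum>j\<in>?V. ?d j * (?d i * ?h i j)) = (\<Sum>i\<in>?V. ?d i * (\<Sum>j\<in>?V. ?d j * ?h j i))"
    by (subst sum.swap) (simp add: sum_distrib_left)
  also have "(\<dots> + \<dots>) / (2 * ?m) = 4 * ?m * kemeny G"
    unfolding half using m by (simp add: power2_eq_square)
  finally show ?thesis by simp
qed

end

section \<open>Bridges\<close>

lemma reachable_refl: "reachable G u u"
  by (simp add: reachable_def)

lemma reachable_trans: "reachable G u v \<Longrightarrow> reachable G v w \<Longrightarrow> reachable G u w"
  unfolding reachable_def by (rule rtrancl_trans)

lemma reachable_sym:
  assumes "reachable G u v"
  shows "reachable G v u"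
proof -
  have "sym {(x, y). {x, y} \<in> edges G}" by (auto simp: sym_def insert_commute)
  then show ?thesis
    using assms unfolding reachable_def by (metis sym_rtrancl symD)
qed

lemma reachable_edge: "{u, v} \<in> edges G \<Longrightarrow> reachable G u v"
  by (auto simp: reachable_def)

definition component_of :: "'a ugraph \<Rightarrow> 'a \<Rightarrow> 'a ugraph" where
  "component_of G v = induced_subgraph G {u \<in> verts G. reachable G v u}"

lemma verts_component_of: "verts (component_of G v) = {u \<in> verts G. reachable G v u}"
  by (simp add: component_of_def induced_subgraph_def)

lemma edges_component_of:
  "edges (component_of G v) = {e \<in> edges G. e \<subseteq> verts (component_of G v)}"
  by (simp add: component_of_def induced_subgraph_def)

lemma graph_components_component_of: "graph_components G = component_of G ` verts G"
  by (simp add: graph_components_def component_of_def)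

lemma component_of_eqI: "reachable G u v \<Longrightarrow> component_of G u = component_of G v"
  unfolding component_of_def by (metis reachable_sym reachable_trans)

text \<open>Reachability is an equivalence, so any vertex can represent its component; the ends of
  the bridge will do so.\<close>

lemma component_eq_component_of:
  assumes "H \<in> graph_components G" "v \<in> verts H"
  shows "H = component_of G v"
  using assms component_of_eqI
  by (fastforce simp: graph_components_component_of verts_component_of)

lemma (in finite_graph) conn_graph_component_of:
  assumes v: "v \<in> verts G"
  shows "conn_graph (component_of G v)"
proof
  let ?H = "component_of G v"
  show "simple_graph ?H"
    using simple finite_verts by (auto simp: simple_graph_def verts_component_of edges_component_of)
  \<comment> \<open>A path from \<open>v\<close> never leaves the component, so all its edges
    survive in the induced subgraph.\<close>
  have from_v: "reachable ?H v u" if "reachable G v u" for u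
    using that unfolding reachable_def
  proof (induction rule: rtrancl_induct)
    case (step y z)
    have e: "{y, z} \<in> edges G" using step.hyps(2) by simp
    have "reachable G v y" using step.hyps(1) by (simp add: reachable_def)
    moreover have "reachable G v z"
      using reachable_trans[OF \<open>reachable G v y\<close> reachable_edge[OF e]] .
    ultimately have "{y, z} \<in> edges ?H"
      using e edge_verts[OF e] by (simp add: edges_component_of verts_component_of)
    then show ?case using step.IH by (simp add: rtrancl.rtrancl_into_rtrancl)
  qed simp
  show "connected_graph ?H"
    unfolding connected_graph_def
  proof (intro conjI ballI)
    show "verts ?H \<noteq> {}" using v reachable_refl[of G v] by (auto simp: verts_component_of)
    fix u w assume "u \<in> verts ?H" "w \<in> verts ?H"
    then have "reachable ?H v u" "reachable ?H v w"
      using from_v by (simp_all add: verts_component_of)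
    then show "reachable ?H u w" by (rule reachable_trans[OF reachable_sym])
  qed
qed

context conn_graph
begin

lemma resistance_self:
  "u \<in> verts G \<Longrightarrow> resistance_matrix G u u = 0"
  by (simp add: resistance_commute_time hitting_time_self)

lemma lap_cong:
  assumes "i \<in> verts G" "\<And>x. x \<in> verts G \<Longrightarrow> f x = g x"
  shows "lap G f i = lap G g i"
  unfolding lap_def using assms neighbours_subset by (intro sum.cong) auto

lemma dipole_potential:
  assumes "u \<in> verts G" "v \<in> verts G"
  obtains f where "\<And>x. x \<in> verts G \<Longrightarrow> lap G f x = basis_vec u x - basis_vec v x"
    and "f u - f v = resistance_matrix G u v"
proof -
  let ?f = "\<lambda>y. (hitting_time G v y - hitting_time G u y) / (2 * real (num_edges G))"
  show thesis
    using that[of ?f] lap_commute_potential[OF assms]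
      resistance_potential[OF assms lap_commute_potential[OF assms]] by simp
qed

lemma vec_mat_basis_vec:
  assumes "v \<in> verts G"
  shows "vec_mat_vec (verts G) x A (basis_vec v) = (\<Sum>u\<in>verts G. x u * A u v)"
proof -
  have "(\<Sum>w\<in>verts G. x u * A u w * basis_vec v w) = x u * A u v" for u
  proof -
    have "(\<Sum>w\<in>verts G. x u * A u w * basis_vec v w) = (\<Sum>w\<in>verts G. if w = v then x u * A u w else 0)"
      by (intro sum.cong) (simp_all add: basis_vec_def)
    then show ?thesis using assms finite_verts by simp
  qed
  then show ?thesis by (simp add: vec_mat_vec_def)
qed

lemma sum_basis_vec:
  assumes "v \<in> verts G"
  shows "(\<Sum>u\<in>verts G. basis_vec v u * f u) = f v"
proof -
  have "(\<Sum>u\<in>verts G. basis_vec v u * f u) = (\<Sum>u\<in>verts G. if u = v then f u else 0)"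
    by (intro sum.cong) (simp_all add: basis_vec_def)
  then show ?thesis using assms finite_verts by simp
qed

end

section \<open>Two disjoint connected graphs joined by one edge\<close>

locale bridge_join =
  G: conn_graph G + G1: conn_graph G1 + G2: conn_graph G2
  for G G1 G2 :: "'a ugraph" +
  fixes v1 v2 :: 'a
  assumes verts: "verts G = verts G1 \<union> verts G2"
    and disjoint: "verts G1 \<inter> verts G2 = {}"
    and edges: "edges G = insert {v1, v2} (edges G1 \<union> edges G2)"
    and v1: "v1 \<in> verts G1" and v2: "v2 \<in> verts G2"
begin

text \<open>The setting is symmetric, so facts proved for the side of \<open>G1\<close> transfer to
  \<open>G2\<close> by interpretation.\<close>

lemma swap: "bridge_join G G2 G1 v2 v1"
  by unfold_locales (use verts disjoint edges v1 v2 in \<open>auto simp: insert_commute\<close>)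

lemma num_edges_join: "num_edges G = num_edges G1 + num_edges G2 + 1"
proof -
  have "e \<subseteq> verts G1 \<and> e \<noteq> {}" if "e \<in> edges G1" for e
    using G1.simple that by (auto simp: simple_graph_def)
  moreover have "e \<subseteq> verts G2" if "e \<in> edges G2" for e
    using G2.simple that by (auto simp: simple_graph_def)
  ultimately have "edges G1 \<inter> edges G2 = {}" "{v1, v2} \<notin> edges G1 \<union> edges G2"
    using disjoint v1 v2 by blast+
  then show ?thesis
    using G1.finite_edges G2.finite_edges by (simp add: num_edges_def edges card_Un_disjoint)
qed

lemma neighbours_join:
  assumes u: "u \<in> verts G1"
  shows "neighbours G u = neighbours G1 u \<union> (if u = v1 then {v2} else {})"
proof (rule set_eqI)
  fix x
  have "{u, x} \<notin> edges G2" using G2.edge_verts u disjoint by blast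
  moreover have "{u, x} = {v1, v2} \<longleftrightarrow> u = v1 \<and> x = v2"
    using u v2 disjoint by (auto simp: doubleton_eq_iff)
  ultimately show "x \<in> neighbours G u \<longleftrightarrow> x \<in> neighbours G1 u \<union> (if u = v1 then {v2} else {})"
    by (auto simp: neighbours_def edges)
qed

lemma v2_not_neighbour: "v2 \<notin> neighbours G1 u"
  using G1.neighbours_subset v2 disjoint by blast

lemma lap_join:
  assumes "u \<in> verts G1"
  shows "lap G f u = lap G1 f u + (if u = v1 then f v1 - f v2 else 0)"
  using v2_not_neighbour G1.finite_neighbours by (simp add: lap_def neighbours_join[OF assms])

lemma degree_vec_join:
  assumes "u \<in> verts G1"
  shows "degree_vec G u = degree_vec G1 u + basis_vec v1 u"
  using v2_not_neighbour G1.finite_neighbours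
  by (simp add: degree_vec_def degree_def neighbours_join[OF assms] basis_vec_def)

text \<open>Source of the factors \<open>2 m + 1\<close>: the bridge raises one degree on this side
  by one.\<close>

lemma sum_degree_vec_join: "(\<Sum>u\<in>verts G1. degree_vec G u) = 2 * real (num_edges G1) + 1"
  using G1.handshake G1.sum_basis_vec[OF v1, of "\<lambda>_. 1"] by (simp add: degree_vec_join sum.distrib)

lemma basis_vec_other:
  "u \<in> verts G1 \<Longrightarrow> x \<in> verts G2 \<Longrightarrow> basis_vec u x = 0"
  "u \<in> verts G2 \<Longrightarrow> x \<in> verts G1 \<Longrightarrow> basis_vec u x = 0"
  using disjoint by (auto simp: basis_vec_def)

text \<open>Extending a potential on \<open>G1\<close> by its value at \<open>v1\<close> makes no current flow in the bridge.\<close>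

lemma resistance_same_side:
  assumes u: "u \<in> verts G1" and w: "w \<in> verts G1"
  shows "resistance_matrix G u w = resistance_matrix G1 u w"
proof -
  interpret S: bridge_join G G2 G1 v2 v1 by (rule swap)
  obtain f where f: "\<And>x. x \<in> verts G1 \<Longrightarrow> lap G1 f x = basis_vec u x - basis_vec w x"
    and R: "f u - f w = resistance_matrix G1 u w"
    using G1.dipole_potential[OF u w] by blast
  define g where "g x = (if x \<in> verts G1 then f x else f v1)" for x
  have g2: "g x = f v1" if "x \<in> verts G2" for x using that disjoint by (auto simp: g_def)
  have bridge_values: "g v1 = f v1" "g v2 = f v1" using v1 g2[OF v2] by (simp_all add: g_def)
  have "resistance_matrix G u w = g u - g w"
  proof (rule G.resistance_potential)
    fix x assume x: "x \<in> verts G"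
    show "lap G g x = basis_vec u x - basis_vec w x"
    proof (cases "x \<in> verts G1")
      case True
      have "lap G1 g x = lap G1 f x" by (rule G1.lap_cong[OF True]) (simp add: g_def)
      then show ?thesis using True f by (simp add: lap_join bridge_values)
    next
      case False
      then have x2: "x \<in> verts G2" using x verts by blast
      have "lap G2 g x = lap G2 (\<lambda>_. f v1) x" by (rule G2.lap_cong[OF x2]) (rule g2)
      then show ?thesis
        using x2 u w by (simp add: S.lap_join G2.lap_const bridge_values basis_vec_other)
    qed
  qed (use u w verts in auto)
  then show ?thesis using u w R by (simp add: g_def)
qed

text \<open>A unit current from \<open>u\<close> to \<open>w\<close> runs from \<open>u\<close> to
  \<open>v1\<close>, over the bridge, and from \<open>v2\<close> to \<open>w\<close>; the potential
  drops add up.\<close>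

lemma resistance_across:
  assumes u: "u \<in> verts G1" and w: "w \<in> verts G2"
  shows "resistance_matrix G u w = resistance_matrix G1 u v1 + 1 + resistance_matrix G2 w v2"
proof -
  interpret S: bridge_join G G2 G1 v2 v1 by (rule swap)
  obtain f where f: "\<And>x. x \<in> verts G1 \<Longrightarrow> lap G1 f x = basis_vec u x - basis_vec v1 x"
    and R1: "f u - f v1 = resistance_matrix G1 u v1"
    using G1.dipole_potential[OF u v1] by blast
  obtain h where h: "\<And>x. x \<in> verts G2 \<Longrightarrow> lap G2 h x = basis_vec v2 x - basis_vec w x"
    and R2: "h v2 - h w = resistance_matrix G2 v2 w"
    using G2.dipole_potential[OF v2 w] by blast
  \<comment> \<open>The shifts give \<open>g v1 = 1\<close> and \<open>g v2 = 0\<close>, so the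
    bridge carries unit current and cancels the sink at \<open>v1\<close> and the source at
    \<open>v2\<close>.\<close>
  define g where "g x = (if x \<in> verts G1 then f x - (f v1 - 1) else h x - h v2)" for x
  have g1: "g x = f x - (f v1 - 1)" if "x \<in> verts G1" for x using that by (simp add: g_def)
  have g2: "g x = h x - h v2" if "x \<in> verts G2" for x using that disjoint by (auto simp: g_def)
  have "resistance_matrix G u w = g u - g w"
  proof (rule G.resistance_potential)
    fix x assume x: "x \<in> verts G"
    show "lap G g x = basis_vec u x - basis_vec w x"
    proof (cases "x \<in> verts G1")
      case True
      have "lap G1 g x = lap G1 (\<lambda>x. f x - (f v1 - 1)) x" by (rule G1.lap_cong[OF True]) (rule g1)
      then show ?thesis
        using True f w g1[OF v1] g2[OF v2]
        by (simp add: lap_join G1.lap_diff G1.lap_const basis_vec_other) (simp add: basis_vec_def)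
    next
      case False
      then have x2: "x \<in> verts G2" using x verts by blast
      have "lap G2 g x = lap G2 (\<lambda>x. h x - h v2) x" by (rule G2.lap_cong[OF x2]) (rule g2)
      then show ?thesis
        using x2 h u g1[OF v1] g2[OF v2]
        by (simp add: S.lap_join G2.lap_diff G2.lap_const basis_vec_other) (simp add: basis_vec_def)
    qed
  qed (use u w verts in auto)
  then show ?thesis
    using g1[OF u] g2[OF w] R1 R2 G2.resistance_sym[OF v2 w] by simp
qed

text \<open>The degrees in \<open>G\<close> and \<open>G1\<close> differ only at \<open>v1\<close>,
  where the resistance to \<open>v1\<close> is 0.\<close>

lemma sum_degree_resistance:
  "(\<Sum>u\<in>verts G1. degree_vec G u * resistance_matrix G1 u v1)
    = vec_mat_vec (verts G1) (degree_vec G1) (resistance_matrix G1) (basis_vec v1)"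
  using G1.sum_basis_vec[OF v1, of "\<lambda>u. resistance_matrix G1 u v1"]
  by (simp add: degree_vec_join G1.vec_mat_basis_vec[OF v1] distrib_right sum.distrib
      G1.resistance_self[OF v1])

text \<open>Expand \<open>(d + e)\<^sup>T R (d + e)\<close> with \<open>e\<close> the basis vector
  of \<open>v1\<close>: the mixed terms agree by symmetry of \<open>R\<close>, and the diagonal
  entry at \<open>v1\<close> is 0.\<close>

lemma quadratic_form_same_side:
  "(\<Sum>u\<in>verts G1. \<Sum>w\<in>verts G1. degree_vec G u * resistance_matrix G u w * degree_vec G w)
    = 4 * real (num_edges G1) * kemeny G1
      + 2 * vec_mat_vec (verts G1) (degree_vec G1) (resistance_matrix G1) (basis_vec v1)"
  (is "?L = _ + 2 * ?a")
proof -
  let ?V = "verts G1" and ?d = "degree_vec G1" and ?R = "resistance_matrix G1" and ?e = "basis_vec v1"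
  have row: "(\<Sum>w\<in>?V. degree_vec G u * resistance_matrix G u w * degree_vec G w)
      = (?d u + ?e u) * ((\<Sum>w\<in>?V. ?R u w * ?d w) + ?R u v1)" if u: "u \<in> ?V" for u
  proof -
    have "(\<Sum>w\<in>?V. degree_vec G u * resistance_matrix G u w * degree_vec G w)
      = (\<Sum>w\<in>?V. (?d u + ?e u) * (?R u w * ?d w + ?e w * ?R u w))"
      using u by (intro sum.cong refl) (simp add: degree_vec_join resistance_same_side algebra_simps)
    then show ?thesis by (simp add: sum.distrib G1.sum_basis_vec[OF v1] flip: sum_distrib_left)
  qed
  have v1_row: "(\<Sum>w\<in>?V. ?R v1 w * ?d w) = ?a"
    unfolding G1.vec_mat_basis_vec[OF v1]
    by (intro sum.cong refl) (simp add: G1.resistance_sym v1)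
  have "?L = (\<Sum>u\<in>?V. ?d u * (\<Sum>w\<in>?V. ?R u w * ?d w) + ?d u * ?R u v1
      + ?e u * ((\<Sum>w\<in>?V. ?R u w * ?d w) + ?R u v1))"
    by (intro sum.cong refl) (simp only: row, simp add: algebra_simps)
  also have "\<dots> = (\<Sum>u\<in>?V. ?d u * (\<Sum>w\<in>?V. ?R u w * ?d w)) + (\<Sum>u\<in>?V. ?d u * ?R u v1) + ?a"
    by (simp add: sum.distrib G1.sum_basis_vec[OF v1] v1_row G1.resistance_self[OF v1])
  also have "(\<Sum>u\<in>?V. ?d u * ?R u v1) = ?a"
    by (simp add: G1.vec_mat_basis_vec[OF v1])
  also have "(\<Sum>u\<in>?V. ?d u * (\<Sum>w\<in>?V. ?R u w * ?d w)) = vec_mat_vec ?V ?d ?R ?d"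
    by (simp add: vec_mat_vec_def sum_distrib_left mult.assoc)
  finally show ?thesis by (simp add: G1.kemeny_resistance)
qed

text \<open>Across the bridge \<open>R\<close> is a function of \<open>u\<close> plus 1 plus a
  function of \<open>w\<close>, so the double sum factors.\<close>

lemma quadratic_form_across:
  "(\<Sum>u\<in>verts G1. \<Sum>w\<in>verts G2. degree_vec G u * resistance_matrix G u w * degree_vec G w)
    = (2 * real (num_edges G2) + 1)
        * vec_mat_vec (verts G1) (degree_vec G1) (resistance_matrix G1) (basis_vec v1)
      + (2 * real (num_edges G1) + 1)
        * vec_mat_vec (verts G2) (degree_vec G2) (resistance_matrix G2) (basis_vec v2)
      + (2 * real (num_edges G1) + 1) * (2 * real (num_edges G2) + 1)"
proof -
  interpret S: bridge_join G G2 G1 v2 v1 by (rule swap)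
  let ?d = "degree_vec G"
  define D1 where "D1 = (\<Sum>u\<in>verts G1. ?d u)"
  define D2 where "D2 = (\<Sum>w\<in>verts G2. ?d w)"
  define a1 where "a1 = (\<Sum>u\<in>verts G1. ?d u * resistance_matrix G1 u v1)"
  define a2 where "a2 = (\<Sum>w\<in>verts G2. ?d w * resistance_matrix G2 w v2)"
  have "(\<Sum>u\<in>verts G1. \<Sum>w\<in>verts G2. ?d u * resistance_matrix G u w * ?d w)
      = (\<Sum>u\<in>verts G1. \<Sum>w\<in>verts G2. (?d u * resistance_matrix G1 u v1) * ?d w + ?d u * ?d w
          + ?d u * (?d w * resistance_matrix G2 w v2))"
    by (intro sum.cong refl) (simp add: resistance_across algebra_simps)
  also have "\<dots> = a1 * D2 + D1 * D2 + D1 * a2"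
    by (simp add: sum.distrib a1_def a2_def D1_def D2_def sum_product)
  finally show ?thesis
    unfolding a1_def a2_def D1_def D2_def sum_degree_resistance S.sum_degree_resistance
      sum_degree_vec_join S.sum_degree_vec_join
    by (simp add: algebra_simps)
qed

theorem kemeny_join:
  "kemeny G =
      real (num_edges G1) / real (num_edges G) * kemeny G1
    + real (num_edges G2) / real (num_edges G) * kemeny G2
    + (real (num_edges G2) + 1) / real (num_edges G)
        * vec_mat_vec (verts G1) (degree_vec G1) (resistance_matrix G1) (basis_vec v1)
    + (real (num_edges G1) + 1) / real (num_edges G)
        * vec_mat_vec (verts G2) (degree_vec G2) (resistance_matrix G2) (basis_vec v2)
    + (2 * real (num_edges G1) + 1) * (2 * real (num_edges G2) + 1) / (2 * real (num_edges G))"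
proof -
  interpret S: bridge_join G G2 G1 v2 v1 by (rule swap)
  define q where "q u w = degree_vec G u * resistance_matrix G u w * degree_vec G w" for u w
  define a1 where "a1 = vec_mat_vec (verts G1) (degree_vec G1) (resistance_matrix G1) (basis_vec v1)"
  define a2 where "a2 = vec_mat_vec (verts G2) (degree_vec G2) (resistance_matrix G2) (basis_vec v2)"
  define m m1 m2 where "m = real (num_edges G)" and "m1 = real (num_edges G1)"
    and "m2 = real (num_edges G2)"
  have m: "m = m1 + m2 + 1" "m > 0"
    using num_edges_join by (simp_all add: m_def m1_def m2_def)
  have "4 * m * kemeny G = (\<Sum>u\<in>verts G. \<Sum>w\<in>verts G. q u w)"
    using G.kemeny_resistance by (simp add: m_def vec_mat_vec_def q_def)
  also have "\<dots> = (\<Sum>u\<in>verts G1. \<Sum>w\<in>verts G1. q u w) + (\<Sum>u\<in>verts G1. \<Sum>w\<in>verts G2. q u w)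
      + ((\<Sum>u\<in>verts G2. \<Sum>w\<in>verts G1. q u w) + (\<Sum>u\<in>verts G2. \<Sum>w\<in>verts G2. q u w))"
    using G1.finite_verts G2.finite_verts disjoint
    by (simp add: verts sum.union_disjoint sum.distrib)
  \<comment> \<open>The coefficient of \<open>a1\<close> is 2 from its own block plus
    \<open>2 * m2 + 1\<close> from each of the two mixed blocks; likewise for
    \<open>a2\<close>.\<close>
  also have "\<dots> = 4 * m1 * kemeny G1 + 4 * m2 * kemeny G2
      + 4 * (m2 + 1) * a1 + 4 * (m1 + 1) * a2 + 2 * (2 * m1 + 1) * (2 * m2 + 1)"
    unfolding q_def quadratic_form_same_side S.quadratic_form_same_side
      quadratic_form_across S.quadratic_form_across
    by (simp add: a1_def a2_def m1_def m2_def algebra_simps)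
  finally have "kemeny G = (4 * m1 * kemeny G1 + 4 * m2 * kemeny G2
      + 4 * (m2 + 1) * a1 + 4 * (m1 + 1) * a2 + 2 * (2 * m1 + 1) * (2 * m2 + 1)) / (4 * m)"
    using m(2) by (simp add: field_simps)
  also have "\<dots> = m1 / m * kemeny G1 + m2 / m * kemeny G2 + (m2 + 1) / m * a1 + (m1 + 1) / m * a2
      + (2 * m1 + 1) * (2 * m2 + 1) / (2 * m)"
    using m(2) by (simp add: field_simps)
  finally show ?thesis
    by (simp only: m_def m1_def m2_def a1_def a2_def)
qed

end

section \<open>From a bridge and its components to the joined graph\<close>

lemma bridge_join_components:
  assumes "simple_graph G" and "connected_graph G" and bridge: "is_bridge G {v1, v2}"
    and comps: "graph_components (delete_edge G {v1, v2}) = {G1, G2}"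
    and v1: "v1 \<in> verts G1" and v2: "v2 \<in> verts G2"
  shows "bridge_join G G1 G2 v1 v2"
proof -
  let ?D = "delete_edge G {v1, v2}"
  interpret G: conn_graph G by unfold_locales fact+
  interpret D: finite_graph ?D
    using G.simple by unfold_locales (simp add: simple_graph_def delete_edge_def)
  have vD: "verts ?D = verts G" and eD: "edges ?D = edges G - {{v1, v2}}"
    by (simp_all add: delete_edge_def)
  have e: "{v1, v2} \<in> edges G" and disconn: "\<not> connected_graph ?D"
    using bridge by (simp_all add: is_bridge_def)
  have G1: "G1 = component_of ?D v1" and G2: "G2 = component_of ?D v2"
    by (rule component_eq_component_of; simp add: comps v1 v2)+
  have in_G: "v1 \<in> verts ?D" "v2 \<in> verts ?D" using G.edge_verts[OF e] vD by simp_all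
  have cover: "u \<in> verts G1 \<or> u \<in> verts G2" if "u \<in> verts ?D" for u
  proof -
    have "component_of ?D u \<in> {G1, G2}"
      using that unfolding comps[symmetric] graph_components_component_of by (rule imageI)
    moreover have "u \<in> verts (component_of ?D u)"
      using that by (simp add: verts_component_of reachable_refl)
    ultimately show ?thesis by auto
  qed
  \<comment> \<open>The set \<open>{G1, G2}\<close> alone does not exclude \<open>G1 = G2\<close>.
    If \<open>v1\<close> reached \<open>v2\<close>, it would reach every vertex and the deletion
    would stay connected.\<close>
  have not_reach: "\<not> reachable ?D v1 v2"
  proof
    assume v12: "reachable ?D v1 v2"
    have from_v1: "reachable ?D v1 u" if "u \<in> verts ?D" for u
      using cover[OF that] reachable_trans[OF v12, of u] unfolding G1 G2 verts_component_of by blast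
    have "connected_graph ?D"
      unfolding connected_graph_def
    proof (intro conjI ballI)
      show "verts ?D \<noteq> {}" using in_G by blast
      fix u w assume "u \<in> verts ?D" "w \<in> verts ?D"
      then show "reachable ?D u w"
        using reachable_trans[OF reachable_sym[OF from_v1] from_v1] by blast
    qed
    with disconn show False ..
  qed
  interpret G1: conn_graph G1 unfolding G1 by (rule D.conn_graph_component_of[OF in_G(1)])
  interpret G2: conn_graph G2 unfolding G2 by (rule D.conn_graph_component_of[OF in_G(2)])
  show ?thesis
  proof
    show "verts G = verts G1 \<union> verts G2"
      using cover vD by (auto simp: G1 G2 verts_component_of)
    show "verts G1 \<inter> verts G2 = {}"
    proof -
      have "\<not> (reachable ?D v1 u \<and> reachable ?D v2 u)" for u
        using not_reach reachable_trans[of ?D v1 u v2] reachable_sym[of ?D v2 u] by blast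
      then show ?thesis unfolding G1 G2 verts_component_of by blast
    qed
    \<comment> \<open>A remaining edge links mutually reachable vertices, so the component of one
      end contains the other.\<close>
    have "d \<in> edges G1 \<union> edges G2" if d: "d \<in> edges ?D" for d
    proof -
      obtain x y where xy: "d = {x, y}"
        using D.simple d by (metis card_2_iff simple_graph_def)
      have "x \<in> verts ?D" "y \<in> verts ?D" "reachable ?D x y"
        using D.edge_verts[of x y] reachable_edge[of x y ?D] d unfolding xy by simp_all
      then have "d \<subseteq> verts G1 \<or> d \<subseteq> verts G2"
        using cover[of x] reachable_trans[of ?D v1 x y] reachable_trans[of ?D v2 x y]
        unfolding xy G1 G2 verts_component_of by blast
      then show ?thesis using d by (auto simp: G1 G2 edges_component_of)
    qed
    then show "edges G = insert {v1, v2} (edges G1 \<union> edges G2)"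
      using e eD by (auto simp: G1 G2 edges_component_of)
  qed (fact v1 v2)+
qed

theorem proposition2p2:
  fixes G G1 G2 :: "'a ugraph" and e :: "'a set" and v1 v2 :: 'a
  assumes "simple_graph G" and "connected_graph G"
    and "is_bridge G e"
    and "graph_components (delete_edge G e) = {G1, G2}"
    and "e = {v1, v2}" and "v1 \<in> verts G1" and "v2 \<in> verts G2"
  shows "kemeny G =
      real (num_edges G1) / real (num_edges G) * kemeny G1
    + real (num_edges G2) / real (num_edges G) * kemeny G2
    + (real (num_edges G2) + 1) / real (num_edges G)
        * vec_mat_vec (verts G1) (degree_vec G1) (resistance_matrix G1) (basis_vec v1)
    + (real (num_edges G1) + 1) / real (num_edges G)
        * vec_mat_vec (verts G2) (degree_vec G2) (resistance_matrix G2) (basis_vec v2)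
    + (2 * real (num_edges G1) + 1) * (2 * real (num_edges G2) + 1) / (2 * real (num_edges G))"
proof -
  have "bridge_join G G1 G2 v1 v2"
    using assms by (intro bridge_join_components) simp_all
  then show ?thesis by (rule bridge_join.kemeny_join)
qed

end
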